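(* Let $\gamma\ge 1$ and let $\{b_n\}_{n\in\mathbb Z}$ be a real sequence with $b_n\ge 0$ for all $n$ and $\{b_n\}\in \ell^{\gamma+1/2}(\mathbb Z)$. Let $\{e_j\}$ be the negative eigenvalues of the operator on $\ell^2(\mathbb Z)$ $$H_D\varphi(n)=-\varphi(n+1)-\varphi(n-1)+2\varphi(n)-b_n\varphi(n),\qquad n\in\mathbb Z.$$ Then $$\sum_j |e_j|^\gamma\le \frac{\pi}{\sqrt3}\,L^{cl}_{\gamma,1}\sum_{n\in\mathbb Z} b_n^{\gamma+1/2},\qquad L^{cl}_{\gamma,1}=\frac{\Gamma(\gamma+1)}{2\sqrt\pi\,\Gamma(\gamma+3/2)}.$$
   Context: The operator is $D^*D-b_n$ where $D\varphi(n)=\varphi(n+1)-\varphi(n)$ on $\ell^2(\mathbb Z)$ and $D^*\varphi(n)=-(\varphi(n)-\varphi(n-1))$; $b_n$ acts as multiplication. *)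

theory Defs
  imports "HOL-Analysis.Analysis"
begin

definition l2_seq :: "(int \<Rightarrow> real) \<Rightarrow> bool" where
  "l2_seq \<phi> \<longleftrightarrow> (\<lambda>n. (\<phi> n)\<^sup>2) summable_on UNIV"

definition Dfw :: "(int \<Rightarrow> real) \<Rightarrow> int \<Rightarrow> real" where
  "Dfw \<phi> n = \<phi> (n + 1) - \<phi> n"

definition Dadj :: "(int \<Rightarrow> real) \<Rightarrow> int \<Rightarrow> real" where
  "Dadj \<phi> n = - (\<phi> n - \<phi> (n - 1))"

definition H_D :: "(int \<Rightarrow> real) \<Rightarrow> (int \<Rightarrow> real) \<Rightarrow> int \<Rightarrow> real" where
  "H_D b \<phi> n = Dadj (Dfw \<phi>) n - b n * \<phi> n"

definition eigvec :: "(int \<Rightarrow> real) \<Rightarrow> real \<Rightarrow> (int \<Rightarrow> real) \<Rightarrow> bool" where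
  "eigvec b e \<phi> \<longleftrightarrow> l2_seq \<phi> \<and> H_D b \<phi> = (\<lambda>n. e * \<phi> n)"

definition is_eigenvalue :: "(int \<Rightarrow> real) \<Rightarrow> real \<Rightarrow> bool" where
  "is_eigenvalue b e \<longleftrightarrow> (\<exists>\<phi>. eigvec b e \<phi> \<and> \<phi> \<noteq> (\<lambda>_. 0))"

definition lin_indep_fun :: "(int \<Rightarrow> real) set \<Rightarrow> bool" where
  "lin_indep_fun S \<longleftrightarrow>
     (\<forall>c. (\<forall>n. (\<Sum>\<phi>\<in>S. c \<phi> * \<phi> n) = 0) \<longrightarrow> (\<forall>\<phi>\<in>S. c \<phi> = 0))"

definition eig_mult :: "(int \<Rightarrow> real) \<Rightarrow> real \<Rightarrow> ennreal" where
  "eig_mult b e = (SUP S \<in> {S. finite S \<and> (\<forall>\<phi>\<in>S. eigvec b e \<phi>) \<and> lin_indep_fun S}.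
                     of_nat (card S))"

definition L_cl :: "real \<Rightarrow> real" where
  "L_cl \<gamma> = Gamma (\<gamma> + 1) / (2 * sqrt pi * Gamma (\<gamma> + 3/2))"

end

theory Submission
  imports Defs
begin

text \<open>
  Telescoping \<open>f\<^sup>2\<close> from both sides gives \<open>(f n)\<^sup>4 \<le> \<parallel>f\<parallel>\<^sup>2 \<parallel>D f\<parallel>\<^sup>2\<close>. Applied to linear combinations of an
  orthonormal system (Eden--Foias) it yields \<open>\<Sum>n. (\<rho> n)\<^sup>3 \<le> \<Sum>j. \<parallel>D \<phi>\<^sub>j\<parallel>\<^sup>2\<close> for the density
  \<open>\<rho> n = \<Sum>j. (\<phi>\<^sub>j n)\<^sup>2\<close>. For eigenvectors with eigenvalues below \<open>-\<tau>\<close> this bounds the sum of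
  \<open>\<bar>e\<^sub>j\<bar> - \<tau>\<close> by \<open>\<Sum>n. (b n - \<tau>) \<rho> n - (\<rho> n)\<^sup>3\<close>, and maximising over \<open>\<rho> n\<close> leaves
  \<open>2 / (3 \<surd>3)\<close> times the sum of \<open>(b n - \<tau>)\<^sub>+\<close> to the power \<open>3/2\<close>. The case \<open>\<gamma> = 1\<close> is \<open>\<tau> = 0\<close>; for \<open>\<gamma> > 1\<close>
  one integrates against \<open>\<tau>\<close> to the power \<open>\<gamma> - 2\<close> (Aizenman--Lieb), both sides being Beta integrals.
  Eigenvalues are simple because the Wronskian of two square summable solutions vanishes.
\<close>

section \<open>Square summable sequences and their inner product\<close>

definition ip :: "(int \<Rightarrow> real) \<Rightarrow> (int \<Rightarrow> real) \<Rightarrow> real" where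
  "ip f g = (\<Sum>\<^sub>\<infinity>n. f n * g n)"

lemma has_sum_diff:
  fixes f g :: "'a \<Rightarrow> real"
  assumes "(f has_sum x) A" "(g has_sum y) A"
  shows "((\<lambda>n. f n - g n) has_sum (x - y)) A"
  using has_sum_add[OF assms(1) has_sum_cmult_right[OF assms(2), of "-1"]] by simp

lemma has_sum_sum:
  fixes f :: "'i \<Rightarrow> 'a \<Rightarrow> real"
  assumes "\<And>i. i \<in> I \<Longrightarrow> (f i has_sum s i) A"
  shows "((\<lambda>n. \<Sum>i\<in>I. f i n) has_sum (\<Sum>i\<in>I. s i)) A"
  using assms
proof (induction I rule: infinite_finite_induct)
  case (insert i I)
  then have "((\<lambda>n. f i n + (\<Sum>i\<in>I. f i n)) has_sum (s i + (\<Sum>i\<in>I. s i))) A"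
    by (intro has_sum_add) auto
  then show ?case using insert.hyps by simp
qed (simp_all add: has_sum_0)

lemma l2_mult_summable:
  assumes "l2_seq f" "l2_seq g"
  shows "(\<lambda>n. f n * g n) summable_on UNIV"
proof -
  have "(\<lambda>n. norm (h n * h n)) summable_on UNIV" if "l2_seq h" for h
    using that unfolding l2_seq_def power2_eq_square by simp
  from abs_summable_product[OF this[OF assms(1)] this[OF assms(2)]]
  show ?thesis by (rule abs_summable_summable)
qed

lemma has_sum_ip:
  assumes "l2_seq f" "l2_seq g"
  shows "((\<lambda>n. f n * g n) has_sum ip f g) UNIV"
  unfolding ip_def using l2_mult_summable[OF assms] by (rule has_sum_infsum)

lemma l2_add:
  assumes "l2_seq f" "l2_seq g"
  shows "l2_seq (\<lambda>n. f n + g n)"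
proof -
  have "(\<lambda>n. (f n)\<^sup>2 + (g n)\<^sup>2 + 2 * (f n * g n)) summable_on UNIV"
    using assms l2_mult_summable[OF assms] unfolding l2_seq_def
    by (intro summable_on_add summable_on_cmult_right)
  then show ?thesis unfolding l2_seq_def by (simp add: power2_sum algebra_simps)
qed

lemma l2_cmult:
  assumes "l2_seq f"
  shows "l2_seq (\<lambda>n. c * f n)"
  using assms unfolding l2_seq_def power_mult_distrib by (rule summable_on_cmult_right)

lemma l2_diff:
  assumes "l2_seq f" "l2_seq g"
  shows "l2_seq (\<lambda>n. f n - g n)"
  using l2_add[OF assms(1) l2_cmult[OF assms(2), of "-1"]] by simp

lemma l2_sum:
  assumes "finite I" "\<And>i. i \<in> I \<Longrightarrow> l2_seq (f i)"
  shows "l2_seq (\<lambda>n. \<Sum>i\<in>I. f i n)"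
  using assms
proof (induction I)
  case empty
  show ?case by (simp add: l2_seq_def)
next
  case (insert i I)
  then show ?case using l2_add[of "f i" "\<lambda>n. \<Sum>i\<in>I. f i n"] by simp
qed

lemma bij_int_shift: "bij_betw (\<lambda>n::int. n + k) UNIV UNIV"
  by (rule bij_betwI[where g = "\<lambda>n. n - k"]) auto

lemma l2_shift:
  assumes "l2_seq f"
  shows "l2_seq (\<lambda>n. f (n + k))"
  using assms unfolding l2_seq_def
  by (subst summable_on_reindex_bij_betw[OF bij_int_shift, of "\<lambda>n. (f n)\<^sup>2" k])

lemma l2_Dfw:
  assumes "l2_seq f"
  shows "l2_seq (Dfw f)"
  using l2_diff[OF l2_shift[OF assms, of 1] assms] unfolding Dfw_def[abs_def] .

lemma ip_commute: "ip f g = ip g f"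
  unfolding ip_def by (simp add: mult.commute)

lemma ip_self_nonneg: "ip f f \<ge> 0"
  unfolding ip_def by (intro infsum_nonneg) simp

lemma ip_add_left:
  assumes "l2_seq f" "l2_seq g" "l2_seq h"
  shows "ip (\<lambda>n. f n + g n) h = ip f h + ip g h"
proof -
  have "((\<lambda>n. f n * h n + g n * h n) has_sum (ip f h + ip g h)) UNIV"
    using assms by (intro has_sum_add has_sum_ip)
  then show ?thesis unfolding ip_def[of "\<lambda>n. f n + g n"]
    by (intro infsumI) (simp add: algebra_simps)
qed

text \<open>The value 0 that \<open>infsum\<close> gives to a divergent sum is compatible with
  scaling, so this holds for arbitrary sequences. Additivity fails for such values, hence the
  \<open>l2_seq\<close> hypotheses of \<open>ip_add_left\<close>.\<close>

lemma ip_cmult_left: "ip (\<lambda>n. c * f n) g = c * ip f g"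
  unfolding ip_def mult.assoc by (rule infsum_cmult_right')

lemma ip_zero_left: "ip (\<lambda>n. 0) g = 0"
  unfolding ip_def by simp

lemma ip_sum_left:
  assumes "finite I" "\<And>i. i \<in> I \<Longrightarrow> l2_seq (f i)" "l2_seq h"
  shows "ip (\<lambda>n. \<Sum>i\<in>I. f i n) h = (\<Sum>i\<in>I. ip (f i) h)"
  using assms(1,2)
proof (induction I)
  case empty
  show ?case by (simp add: ip_zero_left)
next
  case (insert i I)
  have "l2_seq (f i)" "l2_seq (\<lambda>n. \<Sum>i\<in>I. f i n)"
    using insert.prems insert.hyps(1) by (auto intro: l2_sum)
  from ip_add_left[OF this assms(3)] show ?case using insert by simp
qed

lemma ip_lincomb:
  assumes "finite I" "\<And>i. i \<in> I \<Longrightarrow> l2_seq (f i)"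
  shows "ip (\<lambda>n. \<Sum>i\<in>I. c i * f i n) (\<lambda>n. \<Sum>i\<in>I. c i * f i n)
     = (\<Sum>i\<in>I. \<Sum>j\<in>I. c i * c j * ip (f i) (f j))"
proof -
  have l2: "\<And>i. i \<in> I \<Longrightarrow> l2_seq (\<lambda>n. c i * f i n)" by (rule l2_cmult) (rule assms(2))
  then have l2s: "l2_seq (\<lambda>n. \<Sum>i\<in>I. c i * f i n)"
    by (rule l2_sum[OF assms(1)])
  have "ip (\<lambda>n. \<Sum>i\<in>I. c i * f i n) (\<lambda>n. \<Sum>i\<in>I. c i * f i n)
     = (\<Sum>i\<in>I. c i * ip (f i) (\<lambda>n. \<Sum>j\<in>I. c j * f j n))"
    using ip_sum_left[where f = "\<lambda>i n. c i * f i n", OF assms(1) l2 l2s] ip_cmult_left by simp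
  also have "\<dots> = (\<Sum>i\<in>I. c i * (\<Sum>j\<in>I. c j * ip (f j) (f i)))"
  proof (intro sum.cong refl arg_cong2[where f = "(*)"])
    fix i assume "i \<in> I"
    then show "ip (f i) (\<lambda>n. \<Sum>j\<in>I. c j * f j n) = (\<Sum>j\<in>I. c j * ip (f j) (f i))"
      using ip_sum_left[where f = "\<lambda>i n. c i * f i n", OF assms(1) l2 assms(2)] ip_cmult_left
      by (subst ip_commute) simp
  qed
  also have "\<dots> = (\<Sum>i\<in>I. \<Sum>j\<in>I. c i * c j * ip (f i) (f j))"
    by (simp add: sum_distrib_left mult.assoc ip_commute)
  finally show ?thesis .
qed

text \<open>The squared norm of \<open>t * f + g\<close> is a quadratic polynomial in
  \<open>t\<close> that is never negative.\<close>

lemma ip_Cauchy_Schwarz: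
  assumes "l2_seq f" "l2_seq g"
  shows "(ip f g)\<^sup>2 \<le> ip f f * ip g g"
proof -
  have expand: "ip f f * t\<^sup>2 + 2 * t * ip f g + ip g g \<ge> 0" for t
  proof -
    have lf: "l2_seq (\<lambda>n. t * f n)" using assms(1) by (rule l2_cmult)
    have l: "l2_seq (\<lambda>n. t * f n + g n)" by (intro l2_add lf assms)
    have e: "ip (\<lambda>n. t * f n + g n) h = t * ip f h + ip g h" if "l2_seq h" for h
      using lf assms that by (simp add: ip_add_left ip_cmult_left)
    have "ip (\<lambda>n. t * f n + g n) (\<lambda>n. t * f n + g n)
       = t * ip (\<lambda>n. t * f n + g n) f + ip (\<lambda>n. t * f n + g n) g"
      using e[OF l] by (simp add: ip_commute)
    also have "\<dots> = ip f f * t\<^sup>2 + 2 * t * ip f g + ip g g"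
      using e[OF assms(1)] e[OF assms(2)]
      by (simp add: algebra_simps power2_eq_square ip_commute)
    finally show ?thesis using ip_self_nonneg by metis
  qed
  show ?thesis
  proof (cases "ip f f = 0")
    case True
    have "ip f g = 0"
    proof (rule ccontr)
      assume "ip f g \<noteq> 0"
      \<comment> \<open>With \<open>ip f f = 0\<close> the polynomial is affine in \<open>t\<close>,
        and this choice of \<open>t\<close> gives it the value -1.\<close>
      then show False
        using expand[of "- (ip g g + 1) / (2 * ip f g)"] True by (simp add: field_simps)
    qed
    then show ?thesis using True by simp
  next
    case False
    then have p: "ip f f > 0" using ip_self_nonneg[of f] by linarith
    \<comment> \<open>The minimiser of the quadratic is inserted, and multiplication by
      \<open>ip f f\<close> clears the denominator.\<close>
    have "0 \<le> ip f f * (ip f f * (- ip f g / ip f f)\<^sup>2 + 2 * (- ip f g / ip f f) * ip f g + ip g g)"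
      using p by (intro mult_nonneg_nonneg expand) simp
    also have "\<dots> = ip f f * ip g g - (ip f g)\<^sup>2"
      using p by (simp add: field_simps power2_eq_square)
    finally show ?thesis by simp
  qed
qed

lemma ip_shift: "ip (\<lambda>n. f (n + k)) (\<lambda>n. g (n + k)) = ip f g"
  unfolding ip_def by (rule infsum_reindex_bij_betw[OF bij_int_shift, of "\<lambda>n. f n * g n" k])

lemma l2_abs: "l2_seq (\<lambda>n. \<bar>f n\<bar>) \<longleftrightarrow> l2_seq f"
  unfolding l2_seq_def by simp

lemma ip_abs_self: "ip (\<lambda>n. \<bar>f n\<bar>) (\<lambda>n. \<bar>f n\<bar>) = ip f f"
  unfolding ip_def by simp

section \<open>The pointwise bound by the norms of a sequence and of its difference\<close>

lemma l2_tendsto_0: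
  assumes "l2_seq f"
  shows "(\<lambda>k. f (n + int k)) \<longlonglongrightarrow> 0" "(\<lambda>k. f (n - int k)) \<longlonglongrightarrow> 0"
proof -
  have *: "(\<lambda>k. f (h k)) \<longlonglongrightarrow> 0" if "inj h" for h :: "nat \<Rightarrow> int"
  proof -
    have "(\<lambda>n. (f n)\<^sup>2) summable_on range h"
      using assms summable_on_subset_banach unfolding l2_seq_def by blast
    then have "(\<lambda>k. (f (h k))\<^sup>2) summable_on UNIV"
      using summable_on_reindex[OF that, of "\<lambda>n. (f n)\<^sup>2"] by (simp add: o_def)
    then have "summable (\<lambda>k. (f (h k))\<^sup>2)" by (rule summable_on_imp_summable)
    then have "(\<lambda>k. (f (h k))\<^sup>2) \<longlonglongrightarrow> 0" by (rule summable_LIMSEQ_zero)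
    then show ?thesis using tendsto_real_sqrt[of "\<lambda>k. (f (h k))\<^sup>2" 0] by (simp add: tendsto_rabs_zero_iff)
  qed
  show "(\<lambda>k. f (n + int k)) \<longlonglongrightarrow> 0" "(\<lambda>k. f (n - int k)) \<longlonglongrightarrow> 0"
    by (intro *; simp add: inj_def)+
qed

lemma telescope_abs_le:
  fixes g :: "int \<Rightarrow> real"
  shows "\<bar>g (n + int k) - g n\<bar> \<le> (\<Sum>m\<in>{n..<n + int k}. \<bar>g (m + 1) - g m\<bar>)"
proof (induction k)
  case (Suc k)
  have "{n..<n + int (Suc k)} = insert (n + int k) {n..<n + int k}" by auto
  moreover have "\<bar>g (n + int (Suc k)) - g n\<bar>
      \<le> \<bar>g (n + int k + 1) - g (n + int k)\<bar> + \<bar>g (n + int k) - g n\<bar>"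
    by (simp add: algebra_simps)
  ultimately show ?case using Suc by simp
qed simp

text \<open>A discrete Agmon inequality with constant 1. The increment of \<open>f\<close> squared
  factors as \<open>Dfw f m\<close> times \<open>f (m + 1) + f m\<close>; Cauchy-Schwarz is applied
  to the sum of the absolute values of these products.\<close>

lemma l2_sup_bound:
  assumes "l2_seq f"
  shows "(f n) ^ 4 \<le> ip f f * ip (Dfw f) (Dfw f)"
proof -
  define g where "g m = \<bar>f (m + 1) + f m\<bar>" for m
  define d where "d m = \<bar>Dfw f m\<bar>" for m
  have lD: "l2_seq d" unfolding d_def[abs_def] l2_abs using assms by (rule l2_Dfw)
  have ls: "l2_seq (\<lambda>m. f (m + 1))" using assms by (rule l2_shift)
  have lp: "l2_seq (\<lambda>m. f (m + 1) + f m)" using ls assms by (rule l2_add)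
  then have lg: "l2_seq g" unfolding g_def[abs_def] l2_abs .
  have step: "\<bar>(f (m + 1))\<^sup>2 - (f m)\<^sup>2\<bar> = d m * g m" for m
    unfolding d_def g_def Dfw_def abs_mult[symmetric] by (simp add: algebra_simps power2_eq_square)
  have up: "\<bar>(f (n + int k))\<^sup>2 - (f n)\<^sup>2\<bar> + \<bar>(f n)\<^sup>2 - (f (n - int k))\<^sup>2\<bar> \<le> ip d g" for k
  proof -
    have "\<bar>(f (n + int k))\<^sup>2 - (f n)\<^sup>2\<bar> \<le> (\<Sum>m\<in>{n..<n + int k}. d m * g m)"
      using telescope_abs_le[of "\<lambda>m. (f m)\<^sup>2" n k] by (simp add: step)
    moreover have "\<bar>(f n)\<^sup>2 - (f (n - int k))\<^sup>2\<bar> \<le> (\<Sum>m\<in>{n - int k..<n}. d m * g m)"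
      using telescope_abs_le[of "\<lambda>m. (f m)\<^sup>2" "n - int k" k] by (simp add: step)
    \<comment> \<open>The increments to the right and to the left of \<open>n\<close> are disjoint,
      so a single copy of \<open>ip d g\<close> controls both. This yields the factor 2 in front of
      the square of \<open>f n\<close>.\<close>
    moreover have "(\<Sum>m\<in>{n..<n + int k}. d m * g m) + (\<Sum>m\<in>{n - int k..<n}. d m * g m)
        = (\<Sum>m\<in>{n..<n + int k} \<union> {n - int k..<n}. d m * g m)"
      by (rule sum.union_disjoint[symmetric]) auto
    moreover have "(\<Sum>m\<in>{n..<n + int k} \<union> {n - int k..<n}. d m * g m) \<le> ip d g"
      unfolding ip_def
      by (rule finite_sum_le_infsum[OF l2_mult_summable[OF lD lg]]) (auto simp: d_def g_def)
    ultimately show ?thesis by linarith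
  qed
  have lim: "(\<lambda>k. \<bar>(f (n + int k))\<^sup>2 - (f n)\<^sup>2\<bar> + \<bar>(f n)\<^sup>2 - (f (n - int k))\<^sup>2\<bar>)
     \<longlonglongrightarrow> \<bar>0\<^sup>2 - (f n)\<^sup>2\<bar> + \<bar>(f n)\<^sup>2 - 0\<^sup>2\<bar>"
    by (intro tendsto_intros l2_tendsto_0 assms)
  have 1: "2 * (f n)\<^sup>2 \<le> ip d g"
    using LIMSEQ_le_const2[OF lim] up by auto
  \<comment> \<open>Parallelogram law: the defect is the square of \<open>f (m+1) - f m\<close>. The
    resulting 4 cancels the 4 obtained by squaring \<open>2 * (f n)^2\<close>.\<close>
  have gg: "ip g g \<le> 4 * ip f f"
  proof -
    have "((\<lambda>m. 2 * (f (m+1) * f (m+1)) + 2 * (f m * f m)) has_sum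
        (2 * ip (\<lambda>m. f (m+1)) (\<lambda>m. f (m+1)) + 2 * ip f f)) UNIV"
      by (intro has_sum_add has_sum_cmult_right has_sum_ip ls assms)
    then have s: "((\<lambda>m. 2 * (f (m+1) * f (m+1)) + 2 * (f m * f m)) has_sum (4 * ip f f)) UNIV"
      by (simp add: ip_shift)
    have "g m * g m \<le> 2 * (f (m+1) * f (m+1)) + 2 * (f m * f m)" for m
    proof -
      have "2 * (f (m+1) * f (m+1)) + 2 * (f m * f m) - g m * g m = (f (m+1) - f m)\<^sup>2"
        unfolding g_def by (simp add: power2_eq_square algebra_simps)
      then show ?thesis by (smt (verit) zero_le_power2)
    qed
    then show ?thesis using has_sum_mono[OF has_sum_ip[OF lg lg] s] by auto
  qed
  have "4 * (f n) ^ 4 = (2 * (f n)\<^sup>2)\<^sup>2" by (simp add: power_mult_distrib flip: power_mult)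
  also have "\<dots> \<le> (ip d g)\<^sup>2" using 1 by (intro power_mono) auto
  also have "\<dots> \<le> ip d d * ip g g" by (rule ip_Cauchy_Schwarz[OF lD lg])
  also have "\<dots> \<le> ip d d * (4 * ip f f)" by (intro mult_left_mono gg ip_self_nonneg)
  also have "ip d d = ip (Dfw f) (Dfw f)" unfolding d_def[abs_def] by (rule ip_abs_self)
  finally show ?thesis by (simp add: mult.commute)
qed

section \<open>The cubic density bound for finite orthonormal systems\<close>

definition orthonormal :: "'a set \<Rightarrow> ('a \<Rightarrow> int \<Rightarrow> real) \<Rightarrow> bool" where
  "orthonormal J \<phi> \<longleftrightarrow> (\<forall>j\<in>J. l2_seq (\<phi> j)) \<and>
     (\<forall>i\<in>J. \<forall>j\<in>J. ip (\<phi> i) (\<phi> j) = (if i = j then 1 else 0))"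

text \<open>Apply the sup bound to the combination of the \<open>\<phi> j\<close> with coefficients \<open>\<phi> j n\<close> and evaluate at \<open>n\<close>.\<close>

lemma orthonormal_cubic_bound:
  assumes J: "finite J" and on: "orthonormal J \<phi>"
  shows "(\<Sum>j\<in>J. (\<phi> j n)\<^sup>2) ^ 3
     \<le> (\<Sum>i\<in>J. \<Sum>j\<in>J. \<phi> i n * \<phi> j n * ip (Dfw (\<phi> i)) (Dfw (\<phi> j)))"
proof -
  define \<rho> where "\<rho> = (\<Sum>j\<in>J. (\<phi> j n)\<^sup>2)"
  define f where "f m = (\<Sum>j\<in>J. \<phi> j n * \<phi> j m)" for m
  have l: "l2_seq (\<phi> j)" if "j \<in> J" for j using on that unfolding orthonormal_def by blast
  have lf: "l2_seq f" unfolding f_def[abs_def] by (intro l2_sum J l2_cmult l)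
  have fn: "f n = \<rho>" unfolding f_def \<rho>_def by (simp add: power2_eq_square)
  have "ip f f = (\<Sum>i\<in>J. \<Sum>j\<in>J. \<phi> i n * \<phi> j n * ip (\<phi> i) (\<phi> j))"
    unfolding f_def[abs_def] by (rule ip_lincomb[OF J l])
  also have "\<dots> = (\<Sum>i\<in>J. \<Sum>j\<in>J. if i = j then \<phi> i n * \<phi> j n else 0)"
    using on unfolding orthonormal_def by (intro sum.cong refl) auto
  also have "\<dots> = \<rho>" unfolding \<rho>_def using J by (simp add: power2_eq_square)
  finally have ff: "ip f f = \<rho>" .
  have Df: "Dfw f = (\<lambda>m. \<Sum>j\<in>J. \<phi> j n * Dfw (\<phi> j) m)"
    unfolding f_def[abs_def] Dfw_def
    by (simp add: right_diff_distrib sum_subtractf)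
  have D: "ip (Dfw f) (Dfw f)
      = (\<Sum>i\<in>J. \<Sum>j\<in>J. \<phi> i n * \<phi> j n * ip (Dfw (\<phi> i)) (Dfw (\<phi> j)))"
    unfolding Df by (rule ip_lincomb[OF J l2_Dfw[OF l]])
  have rho: "\<rho> \<ge> 0" unfolding \<rho>_def by (intro sum_nonneg) simp
  \<comment> \<open>Both \<open>f n\<close> and \<open>ip f f\<close> equal \<open>\<rho>\<close>,
    so the sup bound compares the fourth power of \<open>\<rho>\<close> with \<open>\<rho>\<close>
    times the energy. One factor cancels unless \<open>\<rho> = 0\<close>, where the claim is only
    nonnegativity of the energy.\<close>
  have "\<rho> * \<rho> ^ 3 \<le> \<rho> * ip (Dfw f) (Dfw f)"
    using l2_sup_bound[OF lf, of n] unfolding fn ff by (simp add: numeral_eq_Suc)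
  then have "\<rho> ^ 3 \<le> ip (Dfw f) (Dfw f)"
    using rho ip_self_nonneg[of "Dfw f"] by (cases "\<rho> = 0") auto
  then show ?thesis unfolding D \<rho>_def .
qed

text \<open>Summation over \<open>n\<close> turns the coefficient of each pair into
  \<open>ip (\<phi> i) (\<phi> j)\<close>, and orthonormality leaves the diagonal.\<close>

lemma orthonormal_cubic_has_sum:
  assumes J: "finite J" and on: "orthonormal J \<phi>"
  shows "((\<lambda>n. \<Sum>i\<in>J. \<Sum>j\<in>J. \<phi> i n * \<phi> j n * ip (Dfw (\<phi> i)) (Dfw (\<phi> j)))
     has_sum (\<Sum>j\<in>J. ip (Dfw (\<phi> j)) (Dfw (\<phi> j)))) UNIV"
proof -
  have l: "l2_seq (\<phi> j)" if "j \<in> J" for j using on that unfolding orthonormal_def by blast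
  have "((\<lambda>n. \<Sum>i\<in>J. \<Sum>j\<in>J. \<phi> i n * \<phi> j n * ip (Dfw (\<phi> i)) (Dfw (\<phi> j)))
     has_sum (\<Sum>i\<in>J. \<Sum>j\<in>J. ip (\<phi> i) (\<phi> j) * ip (Dfw (\<phi> i)) (Dfw (\<phi> j)))) UNIV"
    by (intro has_sum_sum has_sum_cmult_left has_sum_ip l)
  also have "(\<Sum>i\<in>J. \<Sum>j\<in>J. ip (\<phi> i) (\<phi> j) * ip (Dfw (\<phi> i)) (Dfw (\<phi> j)))
     = (\<Sum>i\<in>J. \<Sum>j\<in>J. if i = j then ip (Dfw (\<phi> i)) (Dfw (\<phi> j)) else 0)"
    using on unfolding orthonormal_def by (intro sum.cong refl) auto
  also have "\<dots> = (\<Sum>j\<in>J. ip (Dfw (\<phi> j)) (Dfw (\<phi> j)))" using J by simp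
  finally show ?thesis .
qed

section \<open>The quadratic form of the operator and orthogonality of eigenvectors\<close>

lemma ip_Dfw_eq_ip_Dadj:
  assumes "l2_seq f" "l2_seq g"
  shows "ip (Dfw f) (Dfw g) = ip f (Dadj (Dfw g))"
proof -
  have lD: "l2_seq (Dfw g)" using assms(2) by (rule l2_Dfw)
  have ls: "l2_seq (\<lambda>n. f (n + 1))" using assms(1) by (rule l2_shift)
  have lDs: "l2_seq (\<lambda>n. Dfw g (n + -1))" using lD by (rule l2_shift)
  have "((\<lambda>n. f (n + 1) * Dfw g n - f n * Dfw g n)
      has_sum (ip (\<lambda>n. f (n + 1)) (Dfw g) - ip f (Dfw g))) UNIV"
    by (intro has_sum_diff has_sum_ip ls lD assms)
  then have 1: "ip (Dfw f) (Dfw g) = ip (\<lambda>n. f (n + 1)) (Dfw g) - ip f (Dfw g)"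
    unfolding ip_def[of "Dfw f"] Dfw_def[of f] left_diff_distrib by (rule infsumI)
  have "((\<lambda>n. f n * Dfw g (n + -1) - f n * Dfw g n)
      has_sum (ip f (\<lambda>n. Dfw g (n + -1)) - ip f (Dfw g))) UNIV"
    by (intro has_sum_diff has_sum_ip lDs lD assms)
  then have "((\<lambda>n. f n * Dadj (Dfw g) n)
      has_sum (ip f (\<lambda>n. Dfw g (n + -1)) - ip f (Dfw g))) UNIV"
    by (rule has_sum_cong[THEN iffD1, rotated]) (simp add: Dadj_def algebra_simps)
  then have 2: "ip f (Dadj (Dfw g)) = ip f (\<lambda>n. Dfw g (n + -1)) - ip f (Dfw g)"
    unfolding ip_def[of f "Dadj _"] by (rule infsumI)
  \<comment> \<open>A shift preserves sums over all integers, so summation by parts has no boundary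
    terms.\<close>
  have "ip (\<lambda>n. f (n + 1)) (Dfw g) = ip f (\<lambda>n. Dfw g (n + -1))"
    using ip_shift[of f 1 "\<lambda>n. Dfw g (n + -1)"] by simp
  then show ?thesis using 1 2 by simp
qed

lemma l2_bounded_mult:
  assumes "l2_seq f" and B: "\<And>n. \<bar>b n\<bar> \<le> B"
  shows "l2_seq (\<lambda>n. b n * f n)"
  unfolding l2_seq_def
proof (rule summable_on_comparison_test)
  show "(\<lambda>n. B\<^sup>2 * (f n)\<^sup>2) summable_on UNIV"
    using assms(1) unfolding l2_seq_def by (rule summable_on_cmult_right)
  show "(b n * f n)\<^sup>2 \<le> B\<^sup>2 * (f n)\<^sup>2" for n
    unfolding power_mult_distrib
    using B[of n] by (intro mult_right_mono) (auto simp: abs_le_square_iff[symmetric])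
qed auto

lemma eigvec_Dadj:
  assumes "eigvec b e \<phi>"
  shows "Dadj (Dfw \<phi>) = (\<lambda>n. e * \<phi> n + b n * \<phi> n)"
proof
  fix n
  have "H_D b \<phi> n = e * \<phi> n" using assms unfolding eigvec_def by metis
  then show "Dadj (Dfw \<phi>) n = e * \<phi> n + b n * \<phi> n" unfolding H_D_def by simp
qed

text \<open>Weak form of the eigenvalue equation. Testing with another eigenvector gives
  orthogonality, testing with \<open>\<phi>\<close> itself gives the energy. The bound on
  \<open>b\<close> keeps \<open>b n * \<phi> n\<close> square summable.\<close>

lemma eigvec_ip_Dfw:
  assumes f: "l2_seq f" and e: "eigvec b e \<phi>" and B: "\<And>n. \<bar>b n\<bar> \<le> B"
  shows "ip (Dfw f) (Dfw \<phi>) = e * ip f \<phi> + ip f (\<lambda>n. b n * \<phi> n)"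
proof -
  have l: "l2_seq \<phi>" using e unfolding eigvec_def by blast
  have "ip (Dfw f) (Dfw \<phi>) = ip (\<lambda>n. e * \<phi> n + b n * \<phi> n) f"
    unfolding ip_Dfw_eq_ip_Dadj[OF f l] eigvec_Dadj[OF e] by (rule ip_commute)
  also have "\<dots> = e * ip \<phi> f + ip (\<lambda>n. b n * \<phi> n) f"
    using ip_add_left[OF l2_cmult[OF l] l2_bounded_mult[OF l B] f] by (simp add: ip_cmult_left)
  finally show ?thesis by (simp add: ip_commute)
qed

text \<open>The weak form is evaluated in both orders; the potential terms agree and only the
  eigenvalue terms remain.\<close>

lemma eigvec_orthogonal:
  assumes "eigvec b e \<phi>" "eigvec b e' \<psi>" "e \<noteq> e'" and B: "\<And>n. \<bar>b n\<bar> \<le> B"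
  shows "ip \<phi> \<psi> = 0"
proof -
  have l: "l2_seq \<phi>" "l2_seq \<psi>" using assms unfolding eigvec_def by blast+
  have c: "ip \<psi> (\<lambda>n. b n * \<phi> n) = ip \<phi> (\<lambda>n. b n * \<psi> n)"
    unfolding ip_def by (simp add: mult_ac)
  have "e * ip \<psi> \<phi> + ip \<psi> (\<lambda>n. b n * \<phi> n) = ip (Dfw \<psi>) (Dfw \<phi>)"
    by (rule eigvec_ip_Dfw[OF l(2) assms(1) B, symmetric])
  also have "\<dots> = ip (Dfw \<phi>) (Dfw \<psi>)" by (rule ip_commute)
  also have "\<dots> = e' * ip \<phi> \<psi> + ip \<phi> (\<lambda>n. b n * \<psi> n)"
    by (rule eigvec_ip_Dfw[OF l(1) assms(2) B])
  finally have "e * ip \<phi> \<psi> = e' * ip \<phi> \<psi>" using c ip_commute[of \<psi> \<phi>] by simp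
  then show ?thesis using assms(3) by simp
qed

lemma eigvec_lincomb:
  assumes "eigvec b e \<phi>" "eigvec b e \<psi>"
  shows "eigvec b e (\<lambda>n. c * \<phi> n + d * \<psi> n)"
proof -
  have l: "l2_seq \<phi>" "l2_seq \<psi>" using assms unfolding eigvec_def by blast+
  have H: "H_D b \<phi> n = e * \<phi> n" "H_D b \<psi> n = e * \<psi> n" for n
    using assms unfolding eigvec_def by metis+
  have "H_D b (\<lambda>n. c * \<phi> n + d * \<psi> n) n = c * H_D b \<phi> n + d * H_D b \<psi> n" for n
    unfolding H_D_def Dadj_def Dfw_def by (simp add: algebra_simps)
  then show ?thesis unfolding eigvec_def H
    by (auto intro!: l2_add l2_cmult l simp: algebra_simps)
qed

section \<open>Simplicity of the eigenvalues\<close>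

lemma eigvec_recurrence:
  assumes "eigvec b e \<phi>"
  shows "\<phi> (n + 1) + \<phi> (n - 1) = (2 - b n - e) * \<phi> n"
proof -
  have "H_D b \<phi> n = e * \<phi> n" using assms unfolding eigvec_def by metis
  then show ?thesis unfolding H_D_def Dadj_def Dfw_def by (simp add: algebra_simps)
qed

text \<open>The three-term recurrence propagates two adjacent zeros in both directions.\<close>

lemma eigvec_eq_0:
  assumes e: "eigvec b e \<phi>" and "\<phi> 0 = 0" "\<phi> 1 = 0"
  shows "\<phi> = (\<lambda>_. 0)"
proof -
  have "\<phi> n = 0 \<and> \<phi> (n + 1) = 0" for n
  proof (induction n rule: int_induct[where k = 0])
    case base
    show ?case using assms by simp
  next
    case (step1 i)
    then show ?case using eigvec_recurrence[OF e, of "i + 1"] by simp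
  next
    case (step2 i)
    then show ?case using eigvec_recurrence[OF e, of i] by simp
  qed
  then show ?thesis by blast
qed

text \<open>The Wronskian of two solutions is constant and, both being square summable, tends to 0.\<close>

lemma eigvec_wronskian:
  assumes "eigvec b e \<phi>" "eigvec b e \<psi>"
  shows "\<phi> 1 * \<psi> 0 = \<phi> 0 * \<psi> 1"
proof -
  have l: "l2_seq \<phi>" "l2_seq \<psi>" using assms unfolding eigvec_def by blast+
  define W where "W n = \<phi> (n + 1) * \<psi> n - \<phi> n * \<psi> (n + 1)" for n
  have W: "W (n + 1) = W n" for n
  proof -
    have "W (n + 1) - W n = (\<phi> (n + 1 + 1) + \<phi> (n + 1 - 1)) * \<psi> (n + 1)
        - \<phi> (n + 1) * (\<psi> (n + 1 + 1) + \<psi> (n + 1 - 1))"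
      unfolding W_def by (simp add: algebra_simps)
    also have "\<dots> = 0"
      unfolding eigvec_recurrence[OF assms(1)] eigvec_recurrence[OF assms(2)] by simp
    finally show ?thesis by simp
  qed
  have c: "W (int k) = W 0" for k
  proof (induction k)
    case (Suc k)
    then show ?case using W[of "int k"] by (simp add: add.commute)
  qed simp
  have "(\<lambda>k. \<phi> (1 + int k) * \<psi> (0 + int k) - \<phi> (0 + int k) * \<psi> (1 + int k)) \<longlonglongrightarrow> 0 * 0 - 0 * 0"
    by (intro tendsto_diff tendsto_mult l2_tendsto_0 l)
  then have "(\<lambda>k. W (int k)) \<longlonglongrightarrow> 0" unfolding W_def by (simp add: add.commute)
  then have "W 0 = 0" unfolding c by (simp add: LIMSEQ_const_iff)
  then show ?thesis unfolding W_def by simp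
qed

text \<open>By the Wronskian identity, two combinations of \<open>\<phi>\<close> and
  \<open>\<psi>\<close> vanish at 0 and 1, hence everywhere. Independence then makes their
  coefficients zero, so \<open>\<phi>\<close> itself vanishes at 0 and 1.\<close>

lemma lin_indep_eigvec_card_le_1:
  assumes S: "finite S" "\<forall>\<phi>\<in>S. eigvec b e \<phi>" "lin_indep_fun S"
  shows "card S \<le> 1"
proof (rule ccontr)
  assume "\<not> card S \<le> 1"
  then obtain \<phi> \<psi> where *: "\<phi> \<in> S" "\<psi> \<in> S" "\<phi> \<noteq> \<psi>"
    using S(1) card_le_Suc0_iff_eq[OF S(1)] by auto
  have e: "eigvec b e \<phi>" "eigvec b e \<psi>" using S(2) * by blast+
  have indep: "x = 0 \<and> y = 0" if "\<And>n. x * \<phi> n + y * \<psi> n = 0" for x y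
  proof -
    define c where "c = (\<lambda>_. 0)(\<phi> := x, \<psi> := y)"
    have "(\<Sum>u\<in>S. c u * u n) = (\<Sum>u\<in>{\<phi>, \<psi>}. c u * u n)" for n
      using S(1) * by (intro sum.mono_neutral_right) (auto simp: c_def)
    then have "(\<Sum>u\<in>S. c u * u n) = 0" for n using that[of n] *(3) by (simp add: c_def)
    then have "c \<phi> = 0" "c \<psi> = 0" using S(3) * unfolding lin_indep_fun_def by blast+
    then show ?thesis using *(3) by (simp add: c_def)
  qed
  note W = eigvec_wronskian[OF e]
  have "(\<lambda>n. \<psi> 0 * \<phi> n + (- \<phi> 0) * \<psi> n) = (\<lambda>_. 0)"
    by (rule eigvec_eq_0[OF eigvec_lincomb[OF e]]) (use W in \<open>simp_all add: algebra_simps\<close>)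
  then have 0: "\<phi> 0 = 0" using indep[of "\<psi> 0" "- \<phi> 0"] by (metis neg_equal_0_iff_equal)
  have "(\<lambda>n. \<psi> 1 * \<phi> n + (- \<phi> 1) * \<psi> n) = (\<lambda>_. 0)"
    by (rule eigvec_eq_0[OF eigvec_lincomb[OF e]]) (use W in \<open>simp_all add: algebra_simps\<close>)
  then have 1: "\<phi> 1 = 0" using indep[of "\<psi> 1" "- \<phi> 1"] by (metis neg_equal_0_iff_equal)
  have "\<phi> = (\<lambda>_. 0)" using eigvec_eq_0[OF e(1) 0 1] .
  then show False using indep[of 1 0] by simp
qed

text \<open>Allows one eigenvector per eigenvalue in the estimates that follow.\<close>

lemma eig_mult_le_1: "eig_mult b e \<le> 1"
  unfolding eig_mult_def
  using lin_indep_eigvec_card_le_1[of _ b e] by (intro SUP_least) auto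

section \<open>The bound for sums of shifted eigenvalues\<close>

lemma eigenvalues_orthonormal:
  assumes ev: "\<And>e. e \<in> E \<Longrightarrow> is_eigenvalue b e" and B: "\<And>n. \<bar>b n\<bar> \<le> B"
  obtains \<phi> where "orthonormal E \<phi>" "\<And>e. e \<in> E \<Longrightarrow> eigvec b e (\<phi> e)"
proof -
  have "\<exists>\<phi>. eigvec b e \<phi> \<and> ip \<phi> \<phi> = 1" if eE: "e \<in> E" for e
  proof -
    obtain \<psi> where \<psi>: "eigvec b e \<psi>" "\<psi> \<noteq> (\<lambda>_. 0)"
      using ev[OF eE] unfolding is_eigenvalue_def by blast
    then obtain n where n: "\<psi> n \<noteq> 0" by blast
    have l: "l2_seq \<psi>" using \<psi> unfolding eigvec_def by blast
    have "0 < (\<psi> n) ^ 4" using n by (simp add: zero_less_power_eq)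
    \<comment> \<open>The sup bound serves here as definiteness of the inner product.\<close>
    then have "ip \<psi> \<psi> \<noteq> 0" using l2_sup_bound[OF l, of n] by auto
    then have p: "ip \<psi> \<psi> > 0" using ip_self_nonneg[of \<psi>] by linarith
    define c where "c = 1 / sqrt (ip \<psi> \<psi>)"
    have "ip (\<lambda>n. c * \<psi> n) (\<lambda>n. c * \<psi> n) = c * c * ip \<psi> \<psi>"
      unfolding ip_cmult_left by (subst ip_commute) (simp add: ip_cmult_left)
    also have "\<dots> = 1" unfolding c_def using p by (simp add: field_simps)
    finally show ?thesis using eigvec_lincomb[OF \<psi>(1) \<psi>(1), of c 0] by auto
  qed
  then obtain \<phi> where \<phi>: "\<And>e. e \<in> E \<Longrightarrow> eigvec b e (\<phi> e)" "\<And>e. e \<in> E \<Longrightarrow> ip (\<phi> e) (\<phi> e) = 1"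
    by metis
  have "orthonormal E \<phi>"
    unfolding orthonormal_def
    using \<phi> eigvec_orthogonal[OF \<phi>(1) \<phi>(1) _ B] by (auto simp: eigvec_def)
  then show ?thesis using that \<phi>(1) by blast
qed

text \<open>For \<open>x > 0\<close> the left side is largest at \<open>r = s\<close> with
  \<open>s = sqrt (x / 3)\<close>, where it equals \<open>2 * s ^ 3\<close>. The gap to this maximum
  has a double root at \<open>s\<close> and factors explicitly.\<close>

lemma cubic_young:
  fixes r x :: real
  assumes "r \<ge> 0"
  shows "x * r - r ^ 3 \<le> 2 / (3 * sqrt 3) * max 0 x powr (3/2)"
proof (cases "x \<le> 0")
  case True
  then have "x * r \<le> 0" using assms by (simp add: mult_nonpos_nonneg)
  moreover have "r ^ 3 \<ge> 0" using assms by simp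
  ultimately have "x * r - r ^ 3 \<le> 0" by linarith
  then show ?thesis using True by simp
next
  case False
  define s where "s = sqrt (x / 3)"
  have s: "s > 0" "x = 3 * s\<^sup>2" using False unfolding s_def by auto
  have "x powr (3/2) = x * sqrt x"
    using False powr_add[of x 1 "1/2"] by (simp add: powr_half_sqrt)
  also have "sqrt x = sqrt 3 * s" using s by (simp add: real_sqrt_mult)
  finally have "2 / (3 * sqrt 3) * max 0 x powr (3/2) = 2 * s ^ 3"
    using False s by (simp add: field_simps power2_eq_square power3_eq_cube)
  moreover have "2 * s ^ 3 - (x * r - r ^ 3) = (r - s)\<^sup>2 * (r + 2 * s)"
    unfolding s(2) by (simp add: algebra_simps power2_eq_square power3_eq_cube)
  moreover have "(r - s)\<^sup>2 * (r + 2 * s) \<ge> 0" using s(1) assms by simp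
  ultimately show ?thesis by linarith
qed

lemma sum_shifted_eigenvalues_le:
  assumes J: "finite J" and on: "orthonormal J \<phi>"
    and e: "\<And>j. j \<in> J \<Longrightarrow> eigvec b (e j) (\<phi> j)" and B: "\<And>n. \<bar>b n\<bar> \<le> B"
    and s: "(\<lambda>n. max 0 (b n - \<tau>) powr (3/2)) summable_on UNIV"
  shows "(\<Sum>j\<in>J. - e j - \<tau>) \<le> 2 / (3 * sqrt 3) * (\<Sum>\<^sub>\<infinity>n. max 0 (b n - \<tau>) powr (3/2))"
proof -
  have l: "l2_seq (\<phi> j)" if "j \<in> J" for j using on that unfolding orthonormal_def by blast
  have n1: "ip (\<phi> j) (\<phi> j) = 1" if "j \<in> J" for j using on that unfolding orthonormal_def by simp
  define K where "K = (\<Sum>j\<in>J. ip (Dfw (\<phi> j)) (Dfw (\<phi> j)))"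
  \<comment> \<open>The ordinary kinetic density, the sum of the squares of
    \<open>Dfw (\<phi> j) n\<close>, may vanish where \<open>\<rho> n\<close> does not. The density
    \<open>k\<close> has the same total \<open>K\<close> and dominates the cube of
    \<open>\<rho>\<close> at every point.\<close>
  define k where "k n = (\<Sum>i\<in>J. \<Sum>j\<in>J. \<phi> i n * \<phi> j n * ip (Dfw (\<phi> i)) (Dfw (\<phi> j)))" for n
  define \<rho> where "\<rho> n = (\<Sum>j\<in>J. (\<phi> j n)\<^sup>2)" for n
  have K: "ip (Dfw (\<phi> j)) (Dfw (\<phi> j)) = e j + ip (\<phi> j) (\<lambda>n. b n * \<phi> j n)" if "j \<in> J" for j
    using eigvec_ip_Dfw[OF l e B, OF that that] n1[OF that] by simp
  have "((\<lambda>n. (\<Sum>j\<in>J. \<phi> j n * (b n * \<phi> j n) - \<tau> * (\<phi> j n * \<phi> j n)) - k n)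
      has_sum ((\<Sum>j\<in>J. ip (\<phi> j) (\<lambda>n. b n * \<phi> j n) - \<tau> * ip (\<phi> j) (\<phi> j)) - K)) UNIV"
    unfolding k_def K_def
    by (intro has_sum_diff has_sum_sum has_sum_cmult_right has_sum_ip
        orthonormal_cubic_has_sum[OF J on] l l2_bounded_mult[OF l B])
  also have "(\<Sum>j\<in>J. ip (\<phi> j) (\<lambda>n. b n * \<phi> j n) - \<tau> * ip (\<phi> j) (\<phi> j)) - K = (\<Sum>j\<in>J. - e j - \<tau>)"
    unfolding K_def sum_subtractf[symmetric] by (intro sum.cong refl) (simp add: K n1)
  also have "(\<lambda>n. (\<Sum>j\<in>J. \<phi> j n * (b n * \<phi> j n) - \<tau> * (\<phi> j n * \<phi> j n)) - k n)
      = (\<lambda>n. (b n - \<tau>) * \<rho> n - k n)"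
    unfolding \<rho>_def sum_distrib_left by (simp add: algebra_simps power2_eq_square)
  finally have lhs: "((\<lambda>n. (b n - \<tau>) * \<rho> n - k n) has_sum (\<Sum>j\<in>J. - e j - \<tau>)) UNIV" .
  have rhs: "((\<lambda>n. 2 / (3 * sqrt 3) * max 0 (b n - \<tau>) powr (3/2)) has_sum
      2 / (3 * sqrt 3) * (\<Sum>\<^sub>\<infinity>n. max 0 (b n - \<tau>) powr (3/2))) UNIV"
    using s by (intro has_sum_cmult_right has_sum_infsum)
  show ?thesis
  proof (rule has_sum_mono[OF lhs rhs])
    fix n
    have "\<rho> n ^ 3 \<le> k n" unfolding \<rho>_def k_def by (rule orthonormal_cubic_bound[OF J on])
    moreover have "(b n - \<tau>) * \<rho> n - \<rho> n ^ 3 \<le> 2 / (3 * sqrt 3) * max 0 (b n - \<tau>) powr (3/2)"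
      by (rule cubic_young) (simp add: \<rho>_def sum_nonneg)
    ultimately show "(b n - \<tau>) * \<rho> n - k n \<le> 2 / (3 * sqrt 3) * max 0 (b n - \<tau>) powr (3/2)"
      by linarith
  qed
qed

section \<open>Beta integrals, summability of the excess, and the constants\<close>

lemma ennreal_infsum_int:
  fixes g :: "int \<Rightarrow> real"
  assumes "\<And>n. g n \<ge> 0" "g summable_on UNIV"
  shows "ennreal (\<Sum>\<^sub>\<infinity>n. g n) = (\<Sum>k. ennreal (g (int_decode k)))"
proof -
  have "(g has_sum (\<Sum>\<^sub>\<infinity>n. g n)) UNIV" using assms(2) by (rule has_sum_infsum)
  then have "((\<lambda>k. g (int_decode k)) has_sum (\<Sum>\<^sub>\<infinity>n. g n)) UNIV"
    by (subst has_sum_reindex_bij_betw[OF bij_int_decode])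
  then have "(\<lambda>k. g (int_decode k)) sums (\<Sum>\<^sub>\<infinity>n. g n)" by (rule has_sum_imp_sums)
  then show ?thesis using suminf_ennreal_eq[of "\<lambda>k. g (int_decode k)"] assms(1) by metis
qed

text \<open>Substituting \<open>x * t\<close> for \<open>t\<close> reduces this to the Beta integral
  on the unit interval; the power of \<open>x\<close> collects the Jacobian and the two scaled
  factors. The case \<open>x = 0\<close> is separate because the substitution degenerates.\<close>

lemma nn_integral_Beta_scaled:
  fixes a c x :: real
  assumes a: "a > 0" and c: "c > 0" and x: "x \<ge> 0"
  shows "(\<integral>\<^sup>+t. ennreal (t powr (a - 1) * max 0 (x - t) powr (c - 1)) * indicator {0<..} t \<partial>lborel)
     = ennreal (Beta a c * x powr (a + c - 1))"
proof (cases "x = 0")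
  case True
  have "(\<integral>\<^sup>+t. ennreal (t powr (a - 1) * max 0 (x - t) powr (c - 1)) * indicator {0<..} t \<partial>lborel)
     = (\<integral>\<^sup>+(t::real). 0 \<partial>lborel)"
    using True by (intro nn_integral_cong) (auto simp: indicator_def)
  then show ?thesis using True by simp
next
  case False
  then have x: "x > 0" using x by simp
  define k where "k = x powr (a - 1) * x powr (c - 1)"
  have k: "k \<ge> 0" unfolding k_def by simp
  let ?B = "\<lambda>t::real. t powr (a - 1) * (1 - t) powr (c - 1)"
  have eq: "ennreal ((x * t) powr (a - 1) * max 0 (x - x * t) powr (c - 1)) * indicator {0<..} (x * t)
      = ennreal k * (ennreal (?B t) * indicator {0..1} t)" for t
  proof (cases "0 < t \<and> t < 1")
    case True
    have "max 0 (x - x * t) = x * (1 - t)" using x True by (simp add: algebra_simps)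
    then show ?thesis using True x k unfolding k_def
      by (simp add: powr_mult ennreal_mult'[symmetric] mult_ac indicator_def)
  next
    case False
    \<comment> \<open>The closed indicator on the right includes 0 and 1, but
      \<open>0 powr y = 0\<close> for every \<open>y\<close>, so both sides vanish there
      too.\<close>
    then consider "t \<le> 0" | "t \<ge> 1" by linarith
    then show ?thesis
    proof cases
      case 1
      then show ?thesis using x by (auto simp: indicator_def zero_less_mult_iff)
    next
      case 2
      then have "max 0 (x - x * t) = 0" using x by simp
      then show ?thesis using 2 by (auto simp: indicator_def)
    qed
  qed
  have "(\<integral>\<^sup>+t. ennreal (t powr (a - 1) * max 0 (x - t) powr (c - 1)) * indicator {0<..} t \<partial>lborel)
     = ennreal \<bar>x\<bar> * (\<integral>\<^sup>+t. ennreal ((0 + x * t) powr (a - 1) * max 0 (x - (0 + x * t)) powr (c - 1))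
          * indicator {0<..} (0 + x * t) \<partial>lborel)"
    using x by (intro nn_integral_real_affine) auto
  also have "\<dots> = ennreal x * (\<integral>\<^sup>+t. ennreal k * (ennreal (?B t) * indicator {0..1} t) \<partial>lborel)"
    using x unfolding add_0 eq by simp
  also have "\<dots> = ennreal x * (ennreal k * (\<integral>\<^sup>+t. ennreal (?B t) * indicator {0..1} t \<partial>lborel))"
    by (subst nn_integral_cmult) auto
  also have "(\<integral>\<^sup>+t. ennreal (?B t) * indicator {0..1} t \<partial>lborel) = ennreal (Beta a c)"
    by (rule nn_integral_has_integral_lebesgue'[OF _ has_integral_Beta_real[OF a c]]) simp
  also have "ennreal x * (ennreal k * ennreal (Beta a c)) = ennreal (Beta a c * (x * k))"
    using x k by (simp add: ennreal_mult'[symmetric] mult_ac)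
  also have "x * k = x powr (a + c - 1)"
    unfolding k_def using x powr_add[of x 1 "a - 1"] powr_add[of x a "c - 1"]
    by (simp add: algebra_simps)
  finally show ?thesis .
qed

text \<open>Although \<open>b\<close> need not have a finite sum of powers 3/2, only points with
  \<open>b n > t\<close> contribute. There the nonpositive power \<open>1 - \<gamma>\<close> of
  \<open>b n\<close> is at most that of \<open>t\<close>.\<close>

lemma excess_powr_summable:
  fixes b :: "int \<Rightarrow> real"
  assumes g: "\<gamma> \<ge> 1" and b: "\<And>n. b n \<ge> 0"
    and s: "(\<lambda>n. b n powr (\<gamma> + 1/2)) summable_on UNIV" and t: "t > 0"
  shows "(\<lambda>n. max 0 (b n - t) powr (3/2)) summable_on UNIV"
proof (rule summable_on_comparison_test)
  show "(\<lambda>n. t powr (1 - \<gamma>) * b n powr (\<gamma> + 1/2)) summable_on UNIV"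
    using s by (rule summable_on_cmult_right)
  show "max 0 (b n - t) powr (3/2) \<le> t powr (1 - \<gamma>) * b n powr (\<gamma> + 1/2)" for n
  proof (cases "b n \<le> t")
    case False
    then have "max 0 (b n - t) powr (3/2) \<le> b n powr (3/2)"
      using t by (intro powr_mono2) auto
    also have "\<dots> = b n powr (1 - \<gamma>) * b n powr (\<gamma> + 1/2)"
      by (simp flip: powr_add)
    also have "\<dots> \<le> t powr (1 - \<gamma>) * b n powr (\<gamma> + 1/2)"
      using False t g by (intro mult_right_mono powr_mono2') auto
    finally show ?thesis .
  qed simp
qed auto

text \<open>Supplies the uniform bound on the potential: a single term is at most the whole
  sum.\<close>

lemma summable_powr_bounded:
  fixes b :: "int \<Rightarrow> real"
  assumes p: "p > 0" and b: "\<And>n. b n \<ge> 0" and s: "(\<lambda>n. b n powr p) summable_on UNIV"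
  shows "\<bar>b n\<bar> \<le> (\<Sum>\<^sub>\<infinity>m. b m powr p) powr (1 / p)"
proof -
  have "b n powr p \<le> (\<Sum>\<^sub>\<infinity>m. b m powr p)"
    using finite_sum_le_infsum[OF s, of "{n}"] by simp
  then have "(b n powr p) powr (1 / p) \<le> (\<Sum>\<^sub>\<infinity>m. b m powr p) powr (1 / p)"
    using p by (intro powr_mono2) auto
  then show ?thesis using p b[of n] by (simp add: powr_powr)
qed

lemma Gamma_five_halves: "Gamma (5/2 :: real) = 3/4 * sqrt pi"
proof -
  have n: "x \<notin> \<int>\<^sub>\<le>\<^sub>0" if "x > 0" for x :: real
    using that nonpos_Ints_nonpos[of x] by auto
  have "Gamma (5/2 :: real) = 3/2 * (1/2 * Gamma (1/2))"
    using Gamma_plus1[OF n, of "3/2"] Gamma_plus1[OF n, of "1/2"] by simp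
  then show ?thesis by (simp add: Gamma_one_half_real)
qed

lemma Gamma_two: "Gamma (2 :: real) = 1"
  using Gamma_fact[of 1, where 'a = real] by simp

text \<open>Brings out the constant of \<open>cubic_young\<close>; the value of
  \<open>Gamma (5/2)\<close> absorbs the remaining powers of \<open>pi\<close>.\<close>

lemma L_cl_eq:
  "pi / sqrt 3 * L_cl \<gamma> = 2 / (3 * sqrt 3) * (Gamma (5/2) * Gamma (\<gamma> + 1) / Gamma (\<gamma> + 3/2))"
proof -
  define q where "q = sqrt pi"
  have q: "q > 0" "pi = q * q" unfolding q_def by simp_all
  show ?thesis unfolding L_cl_def Gamma_five_halves q_def[symmetric] unfolding q(2)
    using q(1) by (simp add: field_simps)
qed

lemma L_cl_1: "pi / sqrt 3 * L_cl 1 = 2 / (3 * sqrt 3)"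
proof -
  have "Gamma (5/2 :: real) \<noteq> 0" unfolding Gamma_five_halves by simp
  then show ?thesis unfolding L_cl_eq using Gamma_two by simp
qed

text \<open>Relates the constants of the two Beta integrals below;
  \<open>Gamma (\<gamma> - 1)\<close> is common to both and cancels in their quotient.\<close>

lemma L_cl_Beta:
  assumes "\<gamma> > 1"
  shows "2 / (3 * sqrt 3) * Beta (\<gamma> - 1) (5/2) = Beta (\<gamma> - 1) 2 * (pi / sqrt 3 * L_cl \<gamma>)"
proof -
  have e: "\<gamma> - 1 + 5/2 = \<gamma> + 3/2" "\<gamma> - 1 + 2 = \<gamma> + 1" by simp_all
  have p: "Gamma (\<gamma> + 1) \<noteq> 0"
    using assms Gamma_real_pos[of "\<gamma> + 1"] by linarith
  show ?thesis unfolding L_cl_eq Beta_def e Gamma_two using p by simp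
qed

section \<open>Integration over the shift and the final estimate\<close>

lemma sum_eigenvalues_powr_le:
  fixes b :: "int \<Rightarrow> real"
  assumes g: "\<gamma> \<ge> 1" and b: "\<And>n. b n \<ge> 0"
    and s: "(\<lambda>n. b n powr (\<gamma> + 1/2)) summable_on UNIV"
    and E: "finite E" "\<And>e. e \<in> E \<Longrightarrow> e < 0 \<and> is_eigenvalue b e"
  shows "(\<Sum>e\<in>E. \<bar>e\<bar> powr \<gamma>) \<le> pi / sqrt 3 * L_cl \<gamma> * (\<Sum>\<^sub>\<infinity>n. b n powr (\<gamma> + 1/2))"
proof -
  have B: "\<bar>b n\<bar> \<le> (\<Sum>\<^sub>\<infinity>m. b m powr (\<gamma> + 1/2)) powr (1 / (\<gamma> + 1/2))" for n
    using g by (intro summable_powr_bounded b s) simp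
  have shift: "(\<Sum>e\<in>E. max 0 (\<bar>e\<bar> - t)) \<le> 2 / (3 * sqrt 3) * (\<Sum>\<^sub>\<infinity>n. max 0 (b n - t) powr (3/2))"
    if st: "(\<lambda>n. max 0 (b n - t) powr (3/2)) summable_on UNIV" for t
  proof -
    \<comment> \<open>Terms with \<open>\<bar>e\<bar> \<le> t\<close> contribute 0, and for the
      others \<open>e < 0\<close> turns \<open>\<bar>e\<bar> - t\<close> into
      \<open>- e - t\<close>.\<close>
    define J where "J = {e \<in> E. t < \<bar>e\<bar>}"
    have J: "finite J" "\<And>e. e \<in> J \<Longrightarrow> is_eigenvalue b e" using E unfolding J_def by auto
    obtain \<phi> where "orthonormal J \<phi>" "\<And>e. e \<in> J \<Longrightarrow> eigvec b e (\<phi> e)"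
      using eigenvalues_orthonormal[OF J(2) B] by blast
    from sum_shifted_eigenvalues_le[OF J(1) this B st]
    have "(\<Sum>e\<in>J. - e - t) \<le> 2 / (3 * sqrt 3) * (\<Sum>\<^sub>\<infinity>n. max 0 (b n - t) powr (3/2))" .
    moreover have "(\<Sum>e\<in>E. max 0 (\<bar>e\<bar> - t)) = (\<Sum>e\<in>J. max 0 (\<bar>e\<bar> - t))"
      unfolding J_def using E(1) by (intro sum.mono_neutral_right) auto
    moreover have "(\<Sum>e\<in>J. max 0 (\<bar>e\<bar> - t)) = (\<Sum>e\<in>J. - e - t)"
      using E(2) unfolding J_def by (intro sum.cong refl) fastforce
    ultimately show ?thesis by simp
  qed
  show ?thesis
  proof (cases "\<gamma> = 1")
    case True
    \<comment> \<open>The weight used below is not integrable near 0 when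
      \<open>\<gamma> = 1\<close>. Here the shift \<open>t = 0\<close> suffices, since 3/2 is then
      the given exponent.\<close>
    have "(\<Sum>e\<in>E. \<bar>e\<bar> powr \<gamma>) = (\<Sum>e\<in>E. max 0 (\<bar>e\<bar> - 0))" using True by simp
    also have "\<dots> \<le> 2 / (3 * sqrt 3) * (\<Sum>\<^sub>\<infinity>n. max 0 (b n - 0) powr (3/2))"
      using s b True by (intro shift) (simp add: max_absorb2)
    finally show ?thesis using True b L_cl_1 by (simp add: max_absorb2)
  next
    case False
    then have g1: "\<gamma> > 1" using g by simp
    \<comment> \<open>This weight turns the first power of the excess of
      \<open>\<bar>e\<bar>\<close> into \<open>\<bar>e\<bar> powr \<gamma>\<close>, and the power
      3/2 of the excess of \<open>b n\<close> into \<open>b n powr (\<gamma> + 1/2)\<close>, each up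
      to a Beta factor.\<close>
    define w where "w t = ennreal (t powr (\<gamma> - 2)) * indicator {0<..} t" for t :: real
    have w[measurable]: "w \<in> borel_measurable borel" unfolding w_def[abs_def] by measurable
    define c :: real where "c = 2 / (3 * sqrt 3)"
    have c: "c \<ge> 0" unfolding c_def by simp
    have L: "(\<integral>\<^sup>+t. w t * ennreal (max 0 (\<bar>e\<bar> - t)) \<partial>lborel)
        = ennreal (Beta (\<gamma> - 1) 2 * \<bar>e\<bar> powr \<gamma>)" for e
    proof -
      have "w t * ennreal (max 0 (\<bar>e\<bar> - t))
        = ennreal (t powr (\<gamma> - 1 - 1) * max 0 (\<bar>e\<bar> - t) powr (2 - 1)) * indicator {0<..} t" for t
        unfolding w_def by (simp add: ennreal_mult' mult_ac indicator_def)
      then show ?thesis using nn_integral_Beta_scaled[of "\<gamma> - 1" 2 "\<bar>e\<bar>"] g1 by simp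
    qed
    have R: "(\<integral>\<^sup>+t. w t * ennreal (max 0 (b n - t) powr (3/2)) \<partial>lborel)
        = ennreal (Beta (\<gamma> - 1) (5/2) * b n powr (\<gamma> + 1/2))" for n
    proof -
      have "w t * ennreal (max 0 (b n - t) powr (3/2))
        = ennreal (t powr (\<gamma> - 1 - 1) * max 0 (b n - t) powr (5/2 - 1)) * indicator {0<..} t" for t
        unfolding w_def by (simp add: ennreal_mult' mult_ac indicator_def)
      then show ?thesis using nn_integral_Beta_scaled[of "\<gamma> - 1" "5/2" "b n"] g1 b[of n]
        by (simp add: algebra_simps)
    qed
    have bet: "Beta (\<gamma> - 1) 2 > 0" "Beta (\<gamma> - 1) (5/2) > 0"
      using g1 unfolding Beta_def by (auto intro!: divide_pos_pos mult_pos_pos Gamma_real_pos)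
    have "ennreal (Beta (\<gamma> - 1) 2 * (\<Sum>e\<in>E. \<bar>e\<bar> powr \<gamma>))
        = (\<Sum>e\<in>E. ennreal (Beta (\<gamma> - 1) 2 * \<bar>e\<bar> powr \<gamma>))"
      unfolding sum_distrib_left using bet by (intro sum_ennreal[symmetric]) simp
    also have "\<dots> = (\<integral>\<^sup>+t. (\<Sum>e\<in>E. w t * ennreal (max 0 (\<bar>e\<bar> - t))) \<partial>lborel)"
      unfolding L[symmetric] by (intro nn_integral_sum[symmetric]) measurable
    also have "\<dots> = (\<integral>\<^sup>+t. w t * ennreal (\<Sum>e\<in>E. max 0 (\<bar>e\<bar> - t)) \<partial>lborel)"
      unfolding sum_distrib_left[symmetric] by (subst sum_ennreal) auto
    \<comment> \<open>The sum over the integers is enumerated by \<open>int_decode\<close> as a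
      series of nonnegative functions, so that it can be exchanged with the integral.\<close>
    also have "\<dots> \<le> (\<integral>\<^sup>+t. ennreal c * (\<Sum>k. w t * ennreal (max 0 (b (int_decode k) - t) powr (3/2))) \<partial>lborel)"
    proof (rule nn_integral_mono)
      fix t :: real
      show "w t * ennreal (\<Sum>e\<in>E. max 0 (\<bar>e\<bar> - t))
          \<le> ennreal c * (\<Sum>k. w t * ennreal (max 0 (b (int_decode k) - t) powr (3/2)))"
      \<comment> \<open>Summability of the excess is available for \<open>t > 0\<close> only; for
        other \<open>t\<close> the weight is 0.\<close>
      proof (cases "t > 0")
        case True
        have st: "(\<lambda>n. max 0 (b n - t) powr (3/2)) summable_on UNIV"
          by (rule excess_powr_summable[OF g b s True])
        have "ennreal (\<Sum>e\<in>E. max 0 (\<bar>e\<bar> - t))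
            \<le> ennreal (c * (\<Sum>\<^sub>\<infinity>n. max 0 (b n - t) powr (3/2)))"
          unfolding c_def by (intro ennreal_leI shift st)
        also have "\<dots> = ennreal c * (\<Sum>k. ennreal (max 0 (b (int_decode k) - t) powr (3/2)))"
          using c st by (simp add: ennreal_mult' ennreal_infsum_int)
        finally have "w t * ennreal (\<Sum>e\<in>E. max 0 (\<bar>e\<bar> - t))
            \<le> w t * (ennreal c * (\<Sum>k. ennreal (max 0 (b (int_decode k) - t) powr (3/2))))"
          by (rule mult_left_mono) simp
        then show ?thesis by (simp add: ennreal_suminf_cmult mult_ac)
      qed (simp add: w_def)
    qed
    also have "\<dots> = ennreal c * (\<integral>\<^sup>+t. (\<Sum>k. w t * ennreal (max 0 (b (int_decode k) - t) powr (3/2))) \<partial>lborel)"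
      by (rule nn_integral_cmult) measurable
    also have "\<dots> = ennreal c * (\<Sum>k. \<integral>\<^sup>+t. w t * ennreal (max 0 (b (int_decode k) - t) powr (3/2)) \<partial>lborel)"
      by (subst nn_integral_suminf) measurable
    also have "\<dots> = ennreal c * ennreal (\<Sum>\<^sub>\<infinity>n. Beta (\<gamma> - 1) (5/2) * b n powr (\<gamma> + 1/2))"
      unfolding R using bet s
      by (subst ennreal_infsum_int) (auto intro!: summable_on_cmult_right)
    also have "\<dots> = ennreal (c * (Beta (\<gamma> - 1) (5/2) * (\<Sum>\<^sub>\<infinity>n. b n powr (\<gamma> + 1/2))))"
      using c by (simp add: ennreal_mult' infsum_cmult_right')
    finally have "Beta (\<gamma> - 1) 2 * (\<Sum>e\<in>E. \<bar>e\<bar> powr \<gamma>)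
        \<le> c * (Beta (\<gamma> - 1) (5/2) * (\<Sum>\<^sub>\<infinity>n. b n powr (\<gamma> + 1/2)))"
      using c bet by (subst (asm) ennreal_le_iff) (auto intro!: mult_nonneg_nonneg infsum_nonneg)
    also have "\<dots> = Beta (\<gamma> - 1) 2 * (pi / sqrt 3 * L_cl \<gamma> * (\<Sum>\<^sub>\<infinity>n. b n powr (\<gamma> + 1/2)))"
      using L_cl_Beta[OF g1] unfolding c_def by (metis mult.assoc)
    finally show ?thesis using bet(1) by (rule mult_left_le_imp_le)
  qed
qed

theorem theorem1p3:
  fixes \<gamma> :: real and b :: "int \<Rightarrow> real"
  assumes "\<gamma> \<ge> 1"
    and "\<And>n. b n \<ge> 0"
    and "(\<lambda>n. b n powr (\<gamma> + 1/2)) summable_on UNIV"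
  shows "(\<Sum>\<^sub>\<infinity>e\<in>{e. e < 0 \<and> is_eigenvalue b e}. eig_mult b e * ennreal (\<bar>e\<bar> powr \<gamma>))
          \<le> ennreal (pi / sqrt 3 * L_cl \<gamma> * (\<Sum>\<^sub>\<infinity>n. b n powr (\<gamma> + 1/2)))"
\<comment> \<open>The sum over the possibly infinite set of eigenvalues is bounded through its
  finite partial sums, so only finite sets \<open>E\<close> have to be treated.\<close>
proof (rule infsum_le_finite_sums)
  fix E assume E: "finite E" "E \<subseteq> {e. e < 0 \<and> is_eigenvalue b e}"
  have "(\<Sum>e\<in>E. eig_mult b e * ennreal (\<bar>e\<bar> powr \<gamma>)) \<le> (\<Sum>e\<in>E. 1 * ennreal (\<bar>e\<bar> powr \<gamma>))"
    by (intro sum_mono mult_right_mono eig_mult_le_1) simp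
  also have "\<dots> = ennreal (\<Sum>e\<in>E. \<bar>e\<bar> powr \<gamma>)" by simp
  also have "\<dots> \<le> ennreal (pi / sqrt 3 * L_cl \<gamma> * (\<Sum>\<^sub>\<infinity>n. b n powr (\<gamma> + 1/2)))"
    using E by (intro ennreal_leI sum_eigenvalues_powr_le assms) auto
  finally show "(\<Sum>e\<in>E. eig_mult b e * ennreal (\<bar>e\<bar> powr \<gamma>))
      \<le> ennreal (pi / sqrt 3 * L_cl \<gamma> * (\<Sum>\<^sub>\<infinity>n. b n powr (\<gamma> + 1/2)))" .
qed (simp add: nonneg_summable_on_complete)

end
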